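(* Let $c,s,t$ be positive constants. Suppose that for every irreducible polynomial $Q\in\mathbb{Z}[x]$ of degree $3$, writing $B$ for the absolute value of the leading coefficient of $Q$ and $A:=H(Q)/B$ (where $H(Q)$ is the naive height of $Q$), one has $$\operatorname{sep}(Q)\ge \frac{c}{B^{2+s}A^{2-t}}.$$ Then $$(u,v)=\left(\frac{2(1+s)}{s+t},\; 2+\frac{s}{s+t}\right)\in D_{3,1}.$$
   Context: The naive height $H(P)$ of a polynomial $P\in\mathbb{Z}[x]$ is the maximum of the absolute values of its coefficients. For a real algebraic number $\xi$, $H(\xi)$ denotes the naive height of its minimal polynomial over $\mathbb{Z}$ (primitive, integer coefficients); in particular for a rational $p/q$ in lowest terms, $H(p/q)=\max(|p|,|q|)$. For a polynomial $Q$ of degree at least 2 with no multiple roots, $\operatorname{sep}(Q)$ is the minimum distance between two distinct (complex) roots of $Q$. For a positive integer $d$, $\mathbb{A}_d$ denotes the set of real algebraic numbers of degree exactly $d$ (so $\mathbb{A}_1=\mathbb{Q}$). Two such sets $\mathbb{A}_d,\mathbb{A}_r$ are called $(u,v)$-distanced if there is a constant $c_{d,r}>0$ such that $|\xi-\alpha|\ge c_{d,r}H(\xi)^{-u}H(\alpha)^{-v}$ for all $(\xi,\alpha)\in\mathbb{A}_d\times\mathbb{A}_r$. Then $D_{d,r}$ is the set of pairs $(u,v)$ of positive real numbers such that $\mathbb{A}_d$ and $\mathbb{A}_r$ are $(u,v)$-distanced; in particular $D_{3,1}$ concerns real cubic irrationals $\xi$ and rationals. *)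

theory Defs
  imports Complex_Main "HOL-Computational_Algebra.Computational_Algebra"
begin

definition naive_height :: "int poly \<Rightarrow> int" where
  "naive_height P = Max ((\<lambda>i. \<bar>coeff P i\<bar>) ` {..degree P})"

text \<open>The sign of the minimal polynomial is normalised by a positive leading coefficient.\<close>

definition is_min_int_poly :: "real \<Rightarrow> int poly \<Rightarrow> bool" where
  "is_min_int_poly x P \<longleftrightarrow>
     content P = 1 \<and> lead_coeff P > 0 \<and> poly (map_poly of_int P) x = 0 \<and>
     (\<forall>Q :: int poly. Q \<noteq> 0 \<and> poly (map_poly of_int Q) x = 0 \<longrightarrow> degree P \<le> degree Q)"

definition min_int_poly :: "real \<Rightarrow> int poly" where
  "min_int_poly x = (THE P. is_min_int_poly x P)"

definition alg_height :: "real \<Rightarrow> int" where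
  "alg_height x = naive_height (min_int_poly x)"

definition alg_degree :: "real \<Rightarrow> nat" where
  "alg_degree x = degree (min_int_poly x)"

definition algebraic_reals :: "nat \<Rightarrow> real set" where
  "algebraic_reals d = {x. algebraic x \<and> alg_degree x = d}"

definition complex_roots :: "int poly \<Rightarrow> complex set" where
  "complex_roots Q = {z. poly (map_poly of_int Q) z = 0}"

text \<open>Meaningful for polynomials with at least two distinct complex roots.\<close>

definition sep :: "int poly \<Rightarrow> real" where
  "sep Q = Min {dist z w | z w. z \<in> complex_roots Q \<and> w \<in> complex_roots Q \<and> z \<noteq> w}"

definition distanced :: "nat \<Rightarrow> nat \<Rightarrow> real \<Rightarrow> real \<Rightarrow> bool" where
  "distanced d r u v \<longleftrightarrow>
     (\<exists>c > 0. \<forall>\<xi> \<in> algebraic_reals d. \<forall>\<alpha> \<in> algebraic_reals r.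
        \<bar>\<xi> - \<alpha>\<bar> \<ge> c * real_of_int (alg_height \<xi>) powr (- u) * real_of_int (alg_height \<alpha>) powr (- v))"

definition distance_exponents :: "nat \<Rightarrow> nat \<Rightarrow> (real \<times> real) set" where
  "distance_exponents d r = {(u, v). u > 0 \<and> v > 0 \<and> distanced d r u v}"

lemma is_min_int_poly_unique:
  assumes P: "is_min_int_poly x P" and Q: "is_min_int_poly x Q"
  shows "P = Q"
proof -
  have P0: "P \<noteq> 0" and Q0: "Q \<noteq> 0" using P Q by (auto simp: is_min_int_poly_def)
  have deg: "degree P = degree Q"
    using P Q P0 Q0 unfolding is_min_int_poly_def by (meson le_antisym)
  define R where "R = smult (lead_coeff Q) P - smult (lead_coeff P) Q"
  have "poly (map_poly of_int R) x = 0"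
  proof -
    have "map_poly real_of_int R =
        smult (of_int (lead_coeff Q)) (map_poly of_int P) - smult (of_int (lead_coeff P)) (map_poly of_int Q)"
      by (simp add: R_def poly_eq_iff coeff_map_poly)
    then show ?thesis using P Q by (simp add: is_min_int_poly_def)
  qed
  moreover have "R = 0 \<or> degree R < degree P"
  proof -
    have "degree R \<le> degree P" unfolding R_def
      using deg by (intro degree_diff_le) (auto intro: order.trans[OF degree_smult_le])
    moreover have "coeff R (degree P) = 0" by (simp add: R_def deg mult.commute)
    ultimately show ?thesis
      by (metis le_neq_implies_less leading_coeff_0_iff)
  qed
  ultimately have "R = 0" using P unfolding is_min_int_poly_def by (meson not_less)
  then have eq: "smult (lead_coeff Q) P = smult (lead_coeff P) Q" by (simp add: R_def)
  then have "content (smult (lead_coeff Q) P) = content (smult (lead_coeff P) Q)" by simp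
  then have "lead_coeff Q = lead_coeff P" using P Q by (simp add: is_min_int_poly_def)
  then show ?thesis using eq Q0 by (metis leading_coeff_0_iff smult_cancel)
qed

lemma is_min_int_poly_min_int_poly:
  assumes "algebraic x"
  shows "is_min_int_poly x (min_int_poly x)"
proof -
  define S where "S = (\<lambda>Q :: int poly. Q \<noteq> 0 \<and> poly (map_poly of_int Q) x = 0)"
  obtain p where p: "\<And>i. coeff p i \<in> \<int>" "p \<noteq> 0" "poly p x = 0"
    using assms by (rule algebraicE) blast
  have "map_poly of_int (map_poly floor p) = p"
    using p(1) by (auto simp: poly_eq_iff coeff_map_poly elim!: Ints_cases)
  then have "S (map_poly floor p)" using p by (auto simp: S_def)
  then obtain Q where Q: "S Q" and min: "\<And>R. S R \<Longrightarrow> degree Q \<le> degree R"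
    using ex_has_least_nat[of S _ degree] by blast
  define P where "P = smult (sgn (lead_coeff Q)) (primitive_part Q)"
  have Q0: "Q \<noteq> 0" using Q by (simp add: S_def)
  have QP: "Q = smult (content Q * sgn (lead_coeff Q)) P"
  proof -
    have "sgn (lead_coeff Q) * sgn (lead_coeff Q) = 1" using Q0 by (auto simp: sgn_if)
    then show ?thesis by (simp add: P_def mult.assoc)
  qed
  have c: "content Q > 0"
    using Q0 by (metis content_eq_zero_iff normalize_content normalize_int_def zero_less_abs_iff)
  have lQ: "lead_coeff Q = content Q * lead_coeff (primitive_part Q)"
    by (metis content_times_primitive_part lead_coeff_smult)
  have "is_min_int_poly x P" unfolding is_min_int_poly_def
  proof (intro conjI allI impI)
    show "content P = 1" using Q0 by (auto simp: P_def sgn_if)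
    have "sgn (lead_coeff Q) = sgn (lead_coeff (primitive_part Q))"
      using c by (simp add: lQ sgn_mult)
    then show "lead_coeff P > 0" using Q0 by (auto simp: P_def sgn_if split: if_splits)
    have "map_poly real_of_int Q = smult (of_int (content Q * sgn (lead_coeff Q))) (map_poly of_int P)"
      by (subst QP) (simp add: poly_eq_iff coeff_map_poly)
    then show "poly (map_poly of_int P) x = 0"
      using Q Q0 c by (auto simp: S_def sgn_if split: if_splits)
    fix R :: "int poly" assume "R \<noteq> 0 \<and> poly (map_poly of_int R) x = 0"
    then have "degree Q \<le> degree R" using min by (simp add: S_def)
    then show "degree P \<le> degree R" by (auto simp: P_def sgn_if)
  qed
  then show ?thesis unfolding min_int_poly_def
    by (metis is_min_int_poly_unique theI)
qed

end

theory Submission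
  imports Defs
begin

text \<open>
  Let \<open>\<xi>\<close> have minimal polynomial \<open>P\<close> of height \<open>H\<close> and conjugates \<open>z\<close>, \<open>w\<close>, let \<open>p/q\<close> have height
  \<open>h\<close>, and put \<open>x = q\<^sup>2 \<bar>\<xi> - p/q\<bar>\<close>, which may be assumed small. Choose \<open>a p + b q = 1\<close> with
  \<open>\<bar>a\<bar> \<le> q\<close>. The unimodular map \<open>y \<mapsto> (a y + b) / (q y - p)\<close> sends \<open>\<xi>\<close> to a root of size about
  \<open>1/x\<close> of an integer cubic \<open>Q\<close> with leading coefficient \<open>q\<^sup>3 P(p/q)\<close>, and it pushes the images of
  \<open>z\<close> and \<open>w\<close> together. If \<open>z\<close> and \<open>w\<close> are at distance at least \<open>q\<^sup>-\<^sup>2\<close> from \<open>p/q\<close>, this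
  gives, up to constants, \<open>B \<le> x H h\<close>, \<open>B sep(Q) \<le> x H / h\<close> and \<open>A = 1/x\<close>, so the hypothesis on
  \<open>Q\<close> reads \<open>c \<le> x\<^sup>s\<^sup>+\<^sup>t H\<^sup>2\<^sup>+\<^sup>s h\<^sup>s\<close>, which is the claim. If one of them is closer, then
  \<open>q\<^sup>3 \<bar>P(p/q)\<bar> \<ge> 1\<close> already gives \<open>\<bar>\<xi> - p/q\<bar> \<ge> 1 / (8 H h)\<close>; this is needed only for
  \<open>t \<le> 2\<close>, since for \<open>t > 2\<close> the lower bound for \<open>A\<close> suffices.
\<close>

section \<open>Integer cubics: evaluation and naive height\<close>

lemma cubic_eq_pCons:
  fixes P :: "'a::zero poly"
  assumes "degree P = 3"
  shows "P = [:coeff P 0, coeff P 1, coeff P 2, coeff P 3:]"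
proof (rule poly_eqI)
  fix n :: nat
  consider "n = 0" | "n = 1" | "n = 2" | "n = 3" | "n > 3" by linarith
  then show "coeff P n = coeff [:coeff P 0, coeff P 1, coeff P 2, coeff P 3:] n"
    by cases (auto simp: coeff_pCons eval_nat_numeral coeff_eq_0 assms split: nat.splits)
qed

lemma poly_of_int_cubic:
  "poly (map_poly of_int [:p0, p1, p2, p3:]) (x :: 'a::comm_ring_1)
     = of_int p0 + of_int p1 * x + of_int p2 * x^2 + of_int p3 * x^3"
  by (simp add: map_poly_pCons algebra_simps power2_eq_square power3_eq_cube)

lemma poly_of_int_smult:
  "poly (map_poly of_int (smult k P)) (x :: 'a::comm_ring_1) = of_int k * poly (map_poly of_int P) x"
proof -
  have "map_poly of_int (smult k P) = smult (of_int k) (map_poly of_int P :: 'a poly)"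
    by (simp add: poly_eq_iff coeff_map_poly)
  then show ?thesis by simp
qed

lemma poly_of_int_mult:
  "poly (map_poly of_int (P * Q)) (x :: 'a::comm_ring_1)
     = poly (map_poly of_int P) x * poly (map_poly of_int Q) x"
proof (induction P)
  case (pCons a P)
  have "map_poly of_int (A + B) = (map_poly of_int A + map_poly of_int B :: 'a poly)" for A B
    by (simp add: poly_eq_iff coeff_map_poly)
  then show ?case
    using pCons by (simp add: poly_of_int_smult map_poly_pCons algebra_simps)
qed simp

lemma naive_height_smult:
  assumes "k \<noteq> 0"
  shows "naive_height (smult k P) = \<bar>k\<bar> * naive_height P"
proof -
  have "mono (\<lambda>x::int. \<bar>k\<bar> * x)" by (intro monoI mult_left_mono) auto
  then have "\<bar>k\<bar> * naive_height P = Max ((\<lambda>x. \<bar>k\<bar> * x) ` (\<lambda>i. \<bar>coeff P i\<bar>) ` {..degree P})"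
    unfolding naive_height_def by (intro mono_Max_commute) auto
  also have "\<dots> = naive_height (smult k P)"
    using assms by (simp add: naive_height_def image_image abs_mult)
  finally show ?thesis by simp
qed

lemma abs_coeff_le_naive_height: "\<bar>coeff P i\<bar> \<le> naive_height P"
proof (cases "i \<le> degree P")
  case True
  then show ?thesis unfolding naive_height_def by (intro Max_ge) auto
next
  case False
  \<comment> \<open>Beyond the degree the coefficient is 0, so only nonnegativity of the height is
    needed; the constant coefficient supplies it.\<close>
  have "\<bar>coeff P 0\<bar> \<le> naive_height P" unfolding naive_height_def by (intro Max_ge) auto
  then show ?thesis using False by (simp add: coeff_eq_0)
qed

lemma naive_height_le:
  assumes "\<And>i. i \<le> degree P \<Longrightarrow> real_of_int \<bar>coeff P i\<bar> \<le> M"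
  shows "real_of_int (naive_height P) \<le> M"
proof -
  have "naive_height P \<in> (\<lambda>i. \<bar>coeff P i\<bar>) ` {..degree P}"
    unfolding naive_height_def by (intro Max_in) auto
  then show ?thesis using assms by auto
qed

lemma naive_height_ge_1: "P \<noteq> 0 \<Longrightarrow> naive_height P \<ge> 1"
  using abs_coeff_le_naive_height[of P "degree P"] leading_coeff_0_iff[of P] by linarith

section \<open>Irreducibility of cubics and use of the separation hypothesis\<close>

text \<open>In a factorization of a cubic one factor has degree 0 or 1. A linear factor yields a
  rational root, and a constant factor divides the content, hence is a unit. The criterion makes the
  separation hypothesis applicable to the transformed cubic.\<close>

lemma irreducible_cubicI:
  fixes P :: "int poly"
  assumes deg: "degree P = 3" and cont: "content P = 1"
    and noroot: "\<forall>x\<in>\<rat>. poly (map_poly of_int P) (x::real) \<noteq> 0"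
  shows "irreducible P"
proof (rule irreducibleI)
  show P0: "P \<noteq> 0" using deg by auto
  show "\<not> P dvd 1" using deg by (auto elim!: is_unit_polyE)
  have linear: False if "P = U * V" "degree U = 1" for U V
  proof -
    obtain u0 u1 where U: "U = [:u0, u1:]" "u1 \<noteq> 0"
      using \<open>degree U = 1\<close> by (metis degree1_coeffs)
    have "poly (map_poly of_int P) (- of_int u0 / of_int u1 :: real) = 0"
      unfolding that(1) poly_of_int_mult using U by (simp add: map_poly_pCons)
    then show False using bspec[OF noroot, of "- of_int u0 / of_int u1"] by auto
  qed
  have const: "U dvd 1" if "P = U * V" "degree U = 0" for U V
  proof -
    obtain u where U: "U = [:u:]" using \<open>degree U = 0\<close> by (metis degree_0_id)
    then have "P = smult u V" using \<open>P = U * V\<close> by simp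
    then have "u dvd content P" by simp
    then show ?thesis using cont U by (simp add: is_unit_const_poly_iff)
  qed
  fix U V assume UV: "P = U * V"
  have "degree U + degree V = 3" using UV deg P0 by (metis degree_mult_eq mult_eq_0_iff)
  then consider "degree U = 0" | "degree U = 1" | "degree V = 1" | "degree V = 0" by linarith
  then show "U dvd 1 \<or> V dvd 1"
    using const linear UV by cases (metis mult.commute)+
qed

lemma sep_le_dist:
  assumes "P \<noteq> 0" "z \<in> complex_roots P" "w \<in> complex_roots P" "z \<noteq> w"
  shows "sep P \<le> dist z w"
proof -
  have "finite (complex_roots P)" unfolding complex_roots_def
    using assms(1) by (intro poly_roots_finite) (auto simp: poly_eq_iff coeff_map_poly)
  then have "finite ((\<lambda>(z, w). dist z w) ` (complex_roots P \<times> complex_roots P))" by blast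
  then have "finite {dist z w | z w. z \<in> complex_roots P \<and> w \<in> complex_roots P \<and> z \<noteq> w}"
    by (rule rev_finite_subset) auto
  then show ?thesis unfolding sep_def using assms by (intro Min_le) auto
qed

text \<open>Passing to the primitive part leaves \<open>A\<close> and the roots unchanged and makes \<open>B\<close> smaller.\<close>

lemma root_distance_from_sep_bound:
  fixes c s t :: real and Q :: "int poly"
  assumes s: "s > 0"
    and sep: "\<And>Q :: int poly. irreducible Q \<Longrightarrow> degree Q = 3 \<Longrightarrow>
      (let B = real_of_int \<bar>lead_coeff Q\<bar>;
           A = real_of_int (naive_height Q) / B
       in sep Q \<ge> c / (B powr (2 + s) * A powr (2 - t)))"
    and deg: "degree Q = 3"
    and noroot: "\<forall>x\<in>\<rat>. poly (map_poly of_int Q) (x::real) \<noteq> 0"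
    and roots: "z \<in> complex_roots Q" "w \<in> complex_roots Q" "z \<noteq> w"
  defines "B \<equiv> real_of_int \<bar>lead_coeff Q\<bar>"
  defines "A \<equiv> real_of_int (naive_height Q) / B"
  shows "c \<le> B powr (2 + s) * A powr (2 - t) * dist z w"
proof -
  define k where "k = content Q"
  define R where "R = primitive_part Q"
  have Q0: "Q \<noteq> 0" using deg by auto
  have QR: "Q = smult k R" by (simp add: k_def R_def)
  have k: "k \<ge> 1"
    using Q0 unfolding k_def
    by (metis content_eq_zero_iff normalize_content normalize_int_def zero_less_abs_iff
        int_one_le_iff_zero_less)
  have degR: "degree R = 3" using deg by (simp add: R_def)
  have R0: "R \<noteq> 0" using degR by auto
  have "irreducible R"
  proof (rule irreducible_cubicI[OF degR])
    show "content R = 1" using Q0 by (simp add: R_def)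
    show "\<forall>x\<in>\<rat>. poly (map_poly of_int R) (x::real) \<noteq> 0"
      using noroot by (auto simp: QR poly_of_int_smult)
  qed
  define B' where "B' = real_of_int \<bar>lead_coeff R\<bar>"
  have B: "B = of_int k * B'" using k by (simp add: B_def B'_def QR abs_mult)
  have A: "A = real_of_int (naive_height R) / B'"
    using k by (simp add: A_def B QR naive_height_smult)
  have B'0: "B' > 0" using R0 by (simp add: B'_def)
  have "A > 0" unfolding A using B'0 naive_height_ge_1[OF R0] by simp
  have "sep R \<ge> c / (B' powr (2 + s) * A powr (2 - t))"
    using sep[OF \<open>irreducible R\<close> degR] by (simp add: Let_def A B'_def)
  moreover have "sep R \<le> dist z w"
    using roots k by (intro sep_le_dist R0) (auto simp: complex_roots_def QR poly_of_int_smult)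
  ultimately have "c / (B' powr (2 + s) * A powr (2 - t)) \<le> dist z w" by simp
  then have "c \<le> B' powr (2 + s) * A powr (2 - t) * dist z w"
    using B'0 \<open>A > 0\<close> by (simp add: field_simps)
  also have "\<dots> \<le> B powr (2 + s) * A powr (2 - t) * dist z w"
    using B'0 k s by (intro mult_right_mono powr_mono2) (auto simp: B)
  finally show ?thesis .
qed

section \<open>Minimal polynomials of rationals and of cubic irrationals\<close>

text \<open>A primitive linear polynomial \<open>[:m, q:]\<close> with \<open>q > 0\<close> encodes
  the fraction \<open>-m / q\<close>: primitivity is lowest terms, and its two coefficients give the
  height.\<close>

lemma alg_degree_1_fraction:
  assumes "\<alpha> \<in> algebraic_reals 1"
  obtains p q :: int where "q > 0" "coprime p q" "\<alpha> = of_int p / of_int q"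
    "alg_height \<alpha> = max \<bar>p\<bar> q"
proof -
  define P where "P = min_int_poly \<alpha>"
  have P: "is_min_int_poly \<alpha> P" and deg: "degree P = 1"
    using assms is_min_int_poly_min_int_poly
    by (auto simp: P_def algebraic_reals_def alg_degree_def)
  obtain m q where PE: "P = [:m, q:]" "q \<noteq> 0" using deg by (metis degree1_coeffs)
  have q: "q > 0" and "content P = 1" and root: "of_int m + \<alpha> * of_int q = 0"
    using P PE by (auto simp: is_min_int_poly_def map_poly_pCons)
  then have "coprime m q" using PE by (simp add: content_def coprime_iff_gcd_eq_1 cCons_def)
  moreover have "\<alpha> = of_int (-m) / of_int q" using root q by (simp add: field_simps)
  moreover have "alg_height \<alpha> = max \<bar>-m\<bar> q"
    using q PE by (simp add: alg_height_def P_def[symmetric] naive_height_def atMost_Suc max.commute)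
  ultimately show ?thesis using q that[of q "-m"] by simp
qed

text \<open>A rational root could be divided out, leaving a quadratic that vanishes at
  \<open>\<xi>\<close>, against minimality of the degree.\<close>

lemma alg_degree_3_min_poly:
  assumes "\<xi> \<in> algebraic_reals 3"
  obtains P where "degree P = 3" "alg_height \<xi> = naive_height P"
    "poly (map_poly of_int P) \<xi> = 0"
    "\<forall>x\<in>\<rat>. poly (map_poly of_int P) (x::real) \<noteq> 0"
proof -
  define P where "P = min_int_poly \<xi>"
  have P: "is_min_int_poly \<xi> P" and deg: "degree P = 3"
    using assms is_min_int_poly_min_int_poly
    by (auto simp: P_def algebraic_reals_def alg_degree_def)
  have min: "degree R \<ge> 3" if "R \<noteq> 0" "poly (map_poly of_int R) \<xi> = 0" for R :: "int poly"
    using P deg that by (auto simp: is_min_int_poly_def)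
  have root: "poly (map_poly of_int P) \<xi> = 0" using P by (simp add: is_min_int_poly_def)
  define p0 p1 p2 p3 where "p0 = coeff P 0" "p1 = coeff P 1" "p2 = coeff P 2" "p3 = coeff P 3"
  have PE: "P = [:p0, p1, p2, p3:]" using cubic_eq_pCons[OF deg] by (simp add: p0_p1_p2_p3_def)
  have p3: "p3 \<noteq> 0" using deg p0_p1_p2_p3_def(4) leading_coeff_0_iff[of P] by auto
  have "poly (map_poly of_int P) x \<noteq> 0" if "x \<in> \<rat>" for x :: real
  proof
    assume x0: "poly (map_poly of_int P) x = 0"
    obtain m n :: int where n: "n \<noteq> 0" and x: "x = of_int m / of_int n"
      using \<open>x \<in> \<rat>\<close> by (metis Rats_cases' less_irrefl)
    have "\<xi> \<noteq> x"
    proof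
      assume "\<xi> = x"
      then have "poly (map_poly of_int [:-m, n:]) \<xi> = 0" using n x by (simp add: map_poly_pCons)
      then show False using min[of "[:-m, n:]"] n by simp
    qed
    \<comment> \<open>\<open>S\<close> is the quotient of \<open>P(X) - P(m/n)\<close> by
      \<open>X - m/n\<close>, multiplied by \<open>n^2\<close> to clear denominators. Its leading
      coefficient \<open>p3 * n^2\<close> is non-zero, so its degree is 2.\<close>
    define S where "S = [:p1 * n^2 + p2 * m * n + p3 * m^2, p2 * n^2 + p3 * m * n, p3 * n^2:]"
    have "poly (map_poly of_int S) \<xi> * (\<xi> - x)
        = (of_int n)^2 * (poly (map_poly of_int P) \<xi> - poly (map_poly of_int P) x)"
    proof -
      have m: "real_of_int m = x * of_int n" using n x by simp
      show ?thesis unfolding S_def PE poly_of_int_cubic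
        by (simp add: map_poly_pCons m) algebra
    qed
    then have "poly (map_poly of_int S) \<xi> = 0" using x0 root \<open>\<xi> \<noteq> x\<close> by simp
    then show False using min[of S] n p3 by (simp add: S_def)
  qed
  then show ?thesis using that[of P] deg root by (simp add: alg_height_def P_def[symmetric])
qed


section \<open>The other two roots of a cubic\<close>

text \<open>A double root is a common root of the cubic and its derivative, so the Euclidean
  algorithm computes it rationally from the coefficients. The equality
  \<open>3 * p3 * p1 = p2^2\<close> singles out the triple root.\<close>

lemma cubic_double_root_rational:
  fixes p0 p1 p2 p3 :: int and x y :: real
  assumes "p3 \<noteq> 0" "of_int p2 = - of_int p3 * (x + 2 * y)"
    "of_int p1 = of_int p3 * (2 * x * y + y^2)" "of_int p0 = - of_int p3 * x * y^2"
  shows "y \<in> \<rat>"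
proof (cases "3 * p3 * p1 = p2^2")
  case True
  then have "3 * real_of_int p3 * of_int p1 = (of_int p2)^2"
    by (metis of_int_mult of_int_numeral of_int_power)
  then have "(of_int p3)^2 * (x - y)^2 = 0" unfolding assms by algebra
  then have "x = y" using assms(1) by simp
  then have "y = of_int (- p2) / of_int (3 * p3)" using assms(1,2) by simp
  then show ?thesis by (metis Rats_divide Rats_of_int)
next
  case False
  \<comment> \<open>Dividing \<open>9 * p3\<close> times the cubic by its derivative leaves the
    remainder \<open>(6 * p3 * p1 - 2 * p2^2) * X - (p2 * p1 - 9 * p3 * p0)\<close>, which vanishes
    at \<open>y\<close>.\<close>
  have "of_int (6 * p3 * p1 - 2 * p2^2) * y = of_int (p2 * p1 - 9 * p3 * p0)"
    unfolding of_int_diff of_int_mult of_int_power of_int_numeral assms(2-) by algebra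
  moreover have "6 * p3 * p1 - 2 * p2^2 \<noteq> 0" using False by linarith
  ultimately have "y = of_int (p2 * p1 - 9 * p3 * p0) / of_int (6 * p3 * p1 - 2 * p2^2)"
    by (metis nonzero_eq_divide_eq of_int_eq_0_iff mult.commute)
  then show ?thesis by (metis Rats_divide Rats_of_int)
qed

text \<open>The division by \<open>y - \<xi>\<close> is estimated from the top coefficient down if \<open>\<bar>\<xi>\<bar> \<le> 1\<close> and from
  the bottom up otherwise.\<close>

lemma cubic_quotient_bound:
  fixes p0 p1 p2 p3 \<xi> H :: real
  assumes root: "p0 + p1 * \<xi> + p2 * \<xi>^2 + p3 * \<xi>^3 = 0"
    and H: "\<bar>p0\<bar> \<le> H" "\<bar>p1\<bar> \<le> H" "\<bar>p2\<bar> \<le> H" "\<bar>p3\<bar> \<le> H"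
  defines "b \<equiv> p2 + p3 * \<xi>"
  defines "d \<equiv> p1 + p2 * \<xi> + p3 * \<xi>^2"
  shows "\<bar>p3\<bar> * max 1 \<bar>\<xi>\<bar> \<le> 3 * H" "\<bar>b\<bar> * max 1 \<bar>\<xi>\<bar> \<le> 3 * H" "\<bar>d\<bar> * max 1 \<bar>\<xi>\<bar> \<le> 3 * H"
proof -
  have dE: "d = p1 + b * \<xi>" by (simp add: b_def d_def algebra_simps power2_eq_square)
  have "\<bar>p3\<bar> * max 1 \<bar>\<xi>\<bar> \<le> 3 * H \<and> \<bar>b\<bar> * max 1 \<bar>\<xi>\<bar> \<le> 3 * H \<and> \<bar>d\<bar> * max 1 \<bar>\<xi>\<bar> \<le> 3 * H"
  proof (cases "\<bar>\<xi>\<bar> \<le> 1")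
    case True
    have mul: "\<bar>y * \<xi>\<bar> \<le> \<bar>y\<bar>" for y using True by (simp add: abs_mult mult_left_le)
    have "\<bar>b\<bar> \<le> 2 * H" using mul[of p3] H unfolding b_def by linarith
    moreover from this have "\<bar>d\<bar> \<le> 3 * H" using mul[of b] H unfolding dE by linarith
    ultimately show ?thesis using True H by (auto simp: max_def)
  next
    case False
    have d: "\<bar>d * \<xi>\<bar> \<le> H"
    proof -
      have "d * \<xi> = - p0" using root by (simp add: d_def algebra_simps power2_eq_square power3_eq_cube)
      then show ?thesis using H by simp
    qed
    have mul: "\<bar>y\<bar> \<le> \<bar>y * \<xi>\<bar>" for y
      using False mult_left_mono[of 1 "\<bar>\<xi>\<bar>" "\<bar>y\<bar>"] by (simp add: abs_mult)
    have b: "\<bar>b * \<xi>\<bar> \<le> 2 * H" using dE d mul[of d] H by linarith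
    have "\<bar>p3 * \<xi>\<bar> \<le> 3 * H" using b_def b mul[of b] H by linarith
    moreover have "H \<ge> 0" using H by linarith
    ultimately show ?thesis using False d b by (auto simp: abs_mult max_def)
  qed
  then show "\<bar>p3\<bar> * max 1 \<bar>\<xi>\<bar> \<le> 3 * H" "\<bar>b\<bar> * max 1 \<bar>\<xi>\<bar> \<le> 3 * H" "\<bar>d\<bar> * max 1 \<bar>\<xi>\<bar> \<le> 3 * H"
    by auto
qed

text \<open>The roots \<open>z\<close>, \<open>w\<close> come from the quadratic formula for the
  quotient by \<open>X - \<xi>\<close>, and the bounds from the size of its coefficients. The factor
  \<open>max 1 \<bar>\<xi>\<bar>\<close> is kept because it later absorbs the ratio between the
  height of \<open>p/q\<close> and \<open>q\<close>.\<close>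

lemma cubic_other_roots:
  fixes P :: "int poly" and \<xi> :: real
  assumes P: "P = [:p0, p1, p2, p3:]" "p3 \<noteq> 0"
    and root: "poly (map_poly of_int P) \<xi> = 0"
    and noroot: "\<forall>x\<in>\<rat>. poly (map_poly of_int P) (x::real) \<noteq> 0"
  obtains z w :: complex where "z \<noteq> w"
    "of_int p2 = - of_int p3 * (of_real \<xi> + z + w)"
    "of_int p1 = of_int p3 * (of_real \<xi> * z + of_real \<xi> * w + z * w)"
    "of_int p0 = - of_int p3 * of_real \<xi> * z * w"
    "\<bar>real_of_int p3\<bar> * norm (z - w) * max 1 \<bar>\<xi>\<bar> \<le> 7 * real_of_int (naive_height P)"
    "\<forall>x::real. \<bar>real_of_int p3\<bar> * norm (of_real x - z) * norm (of_real x - w) * max 1 \<bar>\<xi>\<bar>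
       \<le> 9 * real_of_int (naive_height P) * (max 1 \<bar>x\<bar>)^2"
proof -
  define H where "H = real_of_int (naive_height P)"
  define m where "m = max 1 \<bar>\<xi>\<bar>"
  \<comment> \<open>The quotient of the cubic by \<open>X - \<xi>\<close> is
    \<open>a * X^2 + b * X + d\<close>.\<close>
  define b where "b = real_of_int p2 + of_int p3 * \<xi>"
  define d where "d = of_int p1 + of_int p2 * \<xi> + of_int p3 * \<xi>^2"
  define a where "a = real_of_int p3"
  have a0: "a \<noteq> 0" using P by (simp add: a_def)
  have m1: "m \<ge> 1" by (simp add: m_def)
  have root': "of_int p0 + of_int p1 * \<xi> + of_int p2 * \<xi>^2 + of_int p3 * \<xi>^3 = 0"
    using root by (simp only: P poly_of_int_cubic)
  have coeffs: "\<bar>real_of_int p0\<bar> \<le> H" "\<bar>real_of_int p1\<bar> \<le> H" "\<bar>real_of_int p2\<bar> \<le> H" "\<bar>real_of_int p3\<bar> \<le> H"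
    using abs_coeff_le_naive_height[of P 0] abs_coeff_le_naive_height[of P 1]
      abs_coeff_le_naive_height[of P 2] abs_coeff_le_naive_height[of P 3]
    by (simp_all add: H_def P numeral_eq_Suc)
  note quot = cubic_quotient_bound[OF root' coeffs, folded b_def d_def m_def a_def]
  define D where "D = csqrt (of_real (b^2 - 4 * a * d))"
  have D2: "D^2 = of_real (b^2 - 4 * a * d)" by (simp add: D_def)
  define z w where "z = (- of_real b + D) / (2 * of_real a)" "w = (- of_real b - D) / (2 * of_real a)"
  have ac: "complex_of_real a \<noteq> 0" using a0 by simp
  have sum: "of_real a * (z + w) = - of_real b" using ac by (simp add: z_w_def field_simps)
  have prod: "of_real a * (z * w) = of_real d"
  proof -
    have "4 * (of_real a)^2 * (z * w) = (of_real b)^2 - D^2"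
      using ac by (simp add: z_w_def field_simps power2_eq_square)
    also have "\<dots> = 4 * of_real a * of_real d" by (simp add: D2)
    finally have "(4 * of_real a) * (of_real a * (z * w)) = (4 * of_real a) * of_real d"
      by (simp add: power2_eq_square)
    then show ?thesis using ac by (metis mult_left_cancel mult_eq_0_iff zero_neq_numeral)
  qed
  have diff: "of_real a * (z - w) = D" using ac by (simp add: z_w_def field_simps)
  have aE: "complex_of_real a = of_int p3" by (simp add: a_def)
  have p2: "of_int p2 = - of_int p3 * (of_real \<xi> + z + w)"
    using sum unfolding aE by (simp add: b_def) algebra
  have p1: "of_int p1 = of_int p3 * (of_real \<xi> * z + of_real \<xi> * w + z * w)"
    using prod p2 unfolding aE by (simp add: d_def algebra_simps power2_eq_square)
  have p0: "of_int p0 = - of_int p3 * of_real \<xi> * z * w"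
  proof -
    have "complex_of_real (of_int p0 + of_int p1 * \<xi> + of_int p2 * \<xi>^2 + of_int p3 * \<xi>^3) = 0"
      using root' by simp
    then show ?thesis by (simp add: p1 p2) algebra
  qed
  show ?thesis
  proof (rule that[OF _ p2 p1 p0])
    \<comment> \<open>If the discriminant vanished, the double root would be the real number
      \<open>r\<close>, which is then rational.\<close>
    show "z \<noteq> w"
    proof
      assume zw: "z = w"
      define r where "r = - b / (2 * a)"
      have "D = 0" using diff zw by simp
      then have z: "z = of_real r" by (simp add: z_w_def r_def)
      have "complex_of_real (of_int p2) = of_real (- of_int p3 * (\<xi> + 2 * r))"
        using p2 zw z by simp
      moreover have "complex_of_real (of_int p1) = of_real (of_int p3 * (2 * \<xi> * r + r^2))"
        using p1 zw z by (simp add: power2_eq_square)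
      moreover have "complex_of_real (of_int p0) = of_real (- of_int p3 * \<xi> * r^2)"
        using p0 zw z by (simp add: power2_eq_square)
      ultimately have e: "of_int p2 = - of_int p3 * (\<xi> + 2 * r)"
        "of_int p1 = of_int p3 * (2 * \<xi> * r + r^2)" "of_int p0 = - of_int p3 * \<xi> * r^2"
        unfolding of_real_eq_iff by blast+
      have "r \<in> \<rat>" using cubic_double_root_rational[OF P(2) e] .
      moreover have "poly (map_poly of_int P) r = 0"
        unfolding P poly_of_int_cubic e by algebra
      ultimately show False using noroot by blast
    qed
    \<comment> \<open>The discriminant gives \<open>a * (z - w) = D\<close>. The constant 7 arises
      from 3^2 + 4 * 3 * 3 = 45 <= 7^2.\<close>
    have "(\<bar>a\<bar> * norm (z - w) * m)^2 = norm (D^2) * m^2"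
      by (simp add: diff[symmetric] norm_mult norm_power power_mult_distrib)
    also have "\<dots> = \<bar>b^2 - 4 * a * d\<bar> * m^2" unfolding D2 norm_of_real ..
    also have "\<dots> \<le> (\<bar>b\<bar>^2 + 4 * \<bar>a\<bar> * \<bar>d\<bar>) * m^2"
      by (intro mult_right_mono order.trans[OF abs_triangle_ineq4]) (auto simp: abs_mult)
    also have "\<dots> = (\<bar>b\<bar> * m)^2 + 4 * ((\<bar>a\<bar> * m) * (\<bar>d\<bar> * m))"
      by (simp add: algebra_simps power2_eq_square)
    also have "\<dots> \<le> (3 * H)^2 + 4 * ((3 * H) * (3 * H))"
      using quot m1 order.trans[OF abs_ge_zero coeffs(1)]
      by (intro add_mono mult_left_mono mult_mono[of "\<bar>a\<bar> * m"] power_mono) auto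
    also have "\<dots> \<le> (7 * H)^2" by (simp add: power2_eq_square)
    finally show "\<bar>real_of_int p3\<bar> * norm (z - w) * max 1 \<bar>\<xi>\<bar> \<le> 7 * real_of_int (naive_height P)"
      using coeffs(1) unfolding a_def m_def H_def[symmetric] by (auto intro: power2_le_imp_le)
    show "\<forall>x::real. \<bar>real_of_int p3\<bar> * norm (of_real x - z) * norm (of_real x - w) * max 1 \<bar>\<xi>\<bar>
       \<le> 9 * real_of_int (naive_height P) * (max 1 \<bar>x\<bar>)^2"
    proof
      fix x :: real
      define n where "n = max 1 \<bar>x\<bar>"
      have n: "n \<ge> 1" "\<bar>x\<bar> \<le> n" by (auto simp: n_def)
      \<comment> \<open>The product of the two distances is the value of the quotient at
        \<open>x\<close>; each of its three terms contributes \<open>3 * H\<close> to the final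
        \<open>9 * H\<close>.\<close>
      have "of_real a * (of_real x - z) * (of_real x - w)
          = of_real a * (of_real x)^2 - (of_real a * (z + w)) * of_real x + of_real a * (z * w)"
        by (simp add: algebra_simps power2_eq_square)
      also have "\<dots> = complex_of_real (a * x^2 + b * x + d)" unfolding sum prod by simp
      finally have "\<bar>a\<bar> * norm (of_real x - z) * norm (of_real x - w) = \<bar>a * x^2 + b * x + d\<bar>"
        by (metis norm_mult norm_of_real)
      then have "\<bar>a\<bar> * norm (of_real x - z) * norm (of_real x - w) * m = \<bar>a * x^2 + b * x + d\<bar> * m"
        by simp
      also have "\<dots> \<le> (\<bar>a\<bar> * n^2 + \<bar>b\<bar> * n^2 + \<bar>d\<bar> * n^2) * m"
      proof (intro mult_right_mono)
        have "\<bar>a * x^2\<bar> \<le> \<bar>a\<bar> * n^2" using n power_mono[of "\<bar>x\<bar>" n 2] by (simp add: abs_mult mult_left_mono)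
        moreover have "\<bar>b * x\<bar> \<le> \<bar>b\<bar> * n^2"
          using n self_le_power[of n 2] by (auto simp: abs_mult intro!: mult_left_mono)
        moreover have "\<bar>d\<bar> \<le> \<bar>d\<bar> * n^2" using n by (simp add: mult_le_cancel_left1)
        ultimately show "\<bar>a * x^2 + b * x + d\<bar> \<le> \<bar>a\<bar> * n^2 + \<bar>b\<bar> * n^2 + \<bar>d\<bar> * n^2" by linarith
      qed (use m1 in auto)
      also have "\<dots> = (\<bar>a\<bar> * m + \<bar>b\<bar> * m + \<bar>d\<bar> * m) * n^2" by (simp add: algebra_simps)
      also have "\<dots> \<le> (3 * H + 3 * H + 3 * H) * n^2"
        using quot by (intro mult_right_mono add_mono) auto
      finally show "\<bar>real_of_int p3\<bar> * norm (of_real x - z) * norm (of_real x - w) * max 1 \<bar>\<xi>\<bar>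
         \<le> 9 * real_of_int (naive_height P) * (max 1 \<bar>x\<bar>)^2"
        by (simp add: a_def m_def H_def n_def)
    qed
  qed
qed


section \<open>The unimodular transform of a cubic\<close>

text \<open>The substitution \<open>x = (p y + b) / (q y - a)\<close>, with denominators cleared.\<close>

definition mobius_cubic :: "int \<Rightarrow> int \<Rightarrow> int \<Rightarrow> int \<Rightarrow> int poly \<Rightarrow> int poly" where
  "mobius_cubic p b q a P =
    (let p0 = coeff P 0; p1 = coeff P 1; p2 = coeff P 2; p3 = coeff P 3 in
     [: p3 * b^3 - p2 * b^2 * a + p1 * b * a^2 - p0 * a^3,
        3 * p3 * p * b^2 + p2 * (b^2 * q - 2 * p * a * b) + p1 * (p * a^2 - 2 * a * b * q) + 3 * p0 * q * a^2,
        3 * p3 * p^2 * b + p2 * (2 * p * b * q - p^2 * a) + p1 * (b * q^2 - 2 * p * q * a) - 3 * p0 * q^2 * a,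
        p3 * p^3 + p2 * p^2 * q + p1 * p * q^2 + p0 * q^3 :])"

lemma poly_mobius_cubic:
  fixes y :: "'a::field_char_0"
  shows "poly (map_poly of_int (mobius_cubic p b q a P)) y =
    of_int (coeff P 3) * (of_int p * y + of_int b)^3
    + of_int (coeff P 2) * (of_int p * y + of_int b)^2 * (of_int q * y - of_int a)
    + of_int (coeff P 1) * (of_int p * y + of_int b) * (of_int q * y - of_int a)^2
    + of_int (coeff P 0) * (of_int q * y - of_int a)^3"
  unfolding mobius_cubic_def Let_def poly_of_int_cubic
  by simp algebra

lemma poly_mobius_cubic_div:
  fixes y :: "'a::field_char_0"
  assumes "degree P = 3" "of_int q * y \<noteq> of_int a"
  shows "poly (map_poly of_int (mobius_cubic p b q a P)) y =
    (of_int q * y - of_int a)^3 *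
      poly (map_poly of_int P) ((of_int p * y + of_int b) / (of_int q * y - of_int a))"
proof -
  define u where "u = of_int q * y - of_int a"
  define x where "x = (of_int p * y + of_int b) / u"
  have "of_int p * y + of_int b = x * u" using assms by (simp add: x_def u_def)
  moreover have "poly (map_poly of_int P) x
      = of_int (coeff P 0) + of_int (coeff P 1) * x + of_int (coeff P 2) * x^2 + of_int (coeff P 3) * x^3"
    by (metis cubic_eq_pCons[OF assms(1)] poly_of_int_cubic)
  ultimately show ?thesis
    unfolding poly_mobius_cubic u_def[symmetric] x_def[symmetric]
    by (simp add: algebra_simps power_mult_distrib power2_eq_square power3_eq_cube)
qed

text \<open>The substitution maps rationals to rationals, so a rational root of the transform would
  give one of \<open>P\<close>, except where the denominator vanishes.\<close>

lemma mobius_cubic_no_rational_root: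
  fixes x :: real
  assumes P: "degree P = 3"
    and noroot: "\<forall>x\<in>\<rat>. poly (map_poly of_int P) (x::real) \<noteq> 0"
    and det: "a * p + b * q = 1" and "x \<in> \<rat>"
  shows "poly (map_poly of_int (mobius_cubic p b q a P)) x \<noteq> 0"
proof (cases "of_int q * x = of_int a")
  \<comment> \<open>Where the denominator vanishes only the term of \<open>coeff P 3\<close>
    survives, and the determinant condition keeps \<open>p * x + b\<close> away from 0.\<close>
  case True
  have "of_int a * of_int p + of_int b * of_int q = (1::real)"
    using det by (metis of_int_1 of_int_add of_int_mult)
  then have "of_int q * (of_int p * x + of_int b) = (1::real)" using True by algebra
  then have "of_int p * x + of_int b \<noteq> 0" by auto
  moreover have "coeff P 3 \<noteq> 0" using P leading_coeff_0_iff[of P] by auto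
  ultimately show ?thesis using True unfolding poly_mobius_cubic by simp
next
  case False
  have "(of_int p * x + of_int b) / (of_int q * x - of_int a) \<in> \<rat>" using \<open>x \<in> \<rat>\<close> by simp
  then show ?thesis using noroot False unfolding poly_mobius_cubic_div[OF P False] by simp
qed

text \<open>The map \<open>z \<mapsto> (a z + b) / (q z - p)\<close> inverts the substitution, so it
  carries the roots of \<open>P\<close> to roots of the transform.\<close>

lemma mobius_cubic_root:
  fixes z :: "'a::field_char_0"
  assumes P: "degree P = 3" and det: "a * p + b * q = 1"
    and root: "poly (map_poly of_int P) z = 0" and nz: "of_int q * z \<noteq> of_int p"
  shows "poly (map_poly of_int (mobius_cubic p b q a P))
           ((of_int a * z + of_int b) / (of_int q * z - of_int p)) = 0"
proof -
  define e where "e = of_int q * z - of_int p"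
  define y where "y = (of_int a * z + of_int b) / e"
  have e: "e \<noteq> 0" using nz by (simp add: e_def)
  have det': "of_int a * of_int p + of_int b * of_int q = (1::'a)"
    using det by (metis of_int_1 of_int_add of_int_mult)
  have ye: "y * e = of_int a * z + of_int b" using e by (simp add: y_def)
  \<comment> \<open>The determinant condition makes \<open>of_int q * y - of_int a\<close> and
    \<open>e\<close> reciprocal; together with the second identity, substituting \<open>y\<close>
    returns \<open>z\<close>.\<close>
  have "(of_int q * y - of_int a) * e = of_int q * (y * e) - of_int a * e" by (simp add: algebra_simps)
  also have "\<dots> = 1" unfolding ye unfolding e_def using det' by algebra
  finally have 1: "(of_int q * y - of_int a) * e = 1" .
  have "(of_int p * y + of_int b) * e = of_int p * (y * e) + of_int b * e" by (simp add: algebra_simps)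
  also have "\<dots> = z" unfolding ye unfolding e_def using det' by algebra
  finally have 2: "(of_int p * y + of_int b) * e = z" .
  have "of_int q * y - of_int a \<noteq> 0" using 1 by auto
  moreover have "(of_int p * y + of_int b) / (of_int q * y - of_int a) = z"
    using 1 2 e calculation by (metis mult_cancel_right1 nonzero_eq_divide_eq mult.assoc mult.commute mult_1)
  ultimately show ?thesis
    using poly_mobius_cubic_div[OF P, of q y a p b] root by (simp add: y_def e_def)
qed


section \<open>Size, separation and height of the transformed cubic\<close>

text \<open>A Bezout pair may be shifted by multiples of \<open>(q, -p)\<close>, so \<open>a\<close>
  can be reduced modulo \<open>q\<close>. The bound on \<open>a\<close> controls the numerators
  \<open>a v + b\<close> of the transformed roots.\<close>

lemma bezout_bounded:
  fixes p q :: int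
  assumes "coprime p q" "q > 0"
  obtains a b where "a * p + b * q = 1" "\<bar>a\<bar> \<le> q"
proof -
  obtain u v where "u * p + v * q = 1"
    using bezout_int[of p q] assms(1) by (auto simp: coprime_iff_gcd_eq_1)
  moreover have "u = u div q * q + u mod q" by simp
  ultimately have "(u mod q) * p + (v + u div q * p) * q = 1" by algebra
  moreover have "\<bar>u mod q\<bar> \<le> q" using assms(2) by (simp add: abs_le_iff less_imp_le)
  ultimately show ?thesis by (rule that)
qed

text \<open>The leading term at \<open>y\<close> is balanced by three lower terms, each at most the
  height times \<open>y^2\<close>. A large root thus forces a large ratio of height to leading
  coefficient.\<close>

lemma cubic_root_le_height:
  fixes Q :: "int poly" and y :: real
  assumes "degree Q = 3" "poly (map_poly of_int Q) y = 0" "\<bar>y\<bar> \<ge> 1"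
  shows "\<bar>real_of_int (lead_coeff Q)\<bar> * \<bar>y\<bar> \<le> 3 * real_of_int (naive_height Q)"
proof -
  define M where "M = real_of_int (naive_height Q)"
  have le: "\<bar>real_of_int (coeff Q i)\<bar> \<le> M" for i
    unfolding M_def using abs_coeff_le_naive_height[of Q i] by linarith
  have "of_int (coeff Q 0) + of_int (coeff Q 1) * y + of_int (coeff Q 2) * y^2 + of_int (coeff Q 3) * y^3 = 0"
    using assms(2) by (metis cubic_eq_pCons[OF assms(1)] poly_of_int_cubic)
  then have "\<bar>of_int (coeff Q 3) * y^3\<bar>
      = \<bar>of_int (coeff Q 0) + of_int (coeff Q 1) * y + of_int (coeff Q 2) * y^2\<bar>" by linarith
  also have "\<dots> \<le> \<bar>of_int (coeff Q 0)\<bar> + \<bar>of_int (coeff Q 1) * y\<bar> + \<bar>of_int (coeff Q 2) * y^2\<bar>"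
    by linarith
  also have "\<dots> \<le> M * y^2 + M * y^2 + M * y^2"
  proof -
    have y: "1 \<le> y^2" "\<bar>y\<bar> \<le> y^2"
      using assms(3) one_le_power[of "\<bar>y\<bar>" 2] self_le_power[of "\<bar>y\<bar>" 2] by auto
    have "\<bar>real_of_int (coeff Q 0)\<bar> * 1 \<le> M * y^2" using y le[of 0] by (intro mult_mono) auto
    moreover have "\<bar>of_int (coeff Q 1) * y\<bar> \<le> M * y^2"
      unfolding abs_mult using y le[of 1] by (intro mult_mono) auto
    moreover have "\<bar>of_int (coeff Q 2) * y^2\<bar> \<le> M * y^2"
      unfolding abs_mult using le[of 2] by (intro mult_mono) auto
    ultimately show ?thesis by linarith
  qed
  also have "\<bar>of_int (coeff Q 3) * y^3\<bar> = \<bar>of_int (coeff Q 3)\<bar> * \<bar>y\<bar> * y^2"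
    by (simp add: abs_mult power3_eq_cube power2_eq_square)
  finally have "(\<bar>of_int (coeff Q 3)\<bar> * \<bar>y\<bar>) * y^2 \<le> (3 * M) * y^2" by simp
  then have "\<bar>of_int (coeff Q 3)\<bar> * \<bar>y\<bar> \<le> 3 * M"
    using assms(3) by (subst (asm) mult_le_cancel_right) auto
  then show ?thesis using assms(1) by (simp add: M_def)
qed

text \<open>All estimates rest on factoring the transform over the three roots of \<open>P\<close>:
  its leading coefficient is \<open>p3\<close> times the product of the \<open>p - q v\<close>. The
  last bound is conditional because it needs \<open>z\<close> and \<open>w\<close> not too close to
  \<open>p/q\<close>.\<close>

lemma mobius_cubic_estimates:
  fixes P :: "int poly" and \<xi> :: real and p q :: int
  assumes deg: "degree P = 3"
    and root: "poly (map_poly of_int P) \<xi> = 0"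
    and noroot: "\<forall>x\<in>\<rat>. poly (map_poly of_int P) (x::real) \<noteq> 0"
    and pq: "coprime p q" "q > 0"
  defines "H \<equiv> real_of_int (naive_height P)"
  defines "h \<equiv> real_of_int (max \<bar>p\<bar> q)"
  defines "\<epsilon> \<equiv> \<bar>\<xi> - of_int p / of_int q\<bar>"
  defines "x \<equiv> (of_int q)^2 * \<epsilon>"
  assumes small: "x < 1/8"
  obtains Q y w where "degree Q = 3" "\<forall>x\<in>\<rat>. poly (map_poly of_int Q) (x::real) \<noteq> 0"
    "y \<in> complex_roots Q" "w \<in> complex_roots Q" "y \<noteq> w"
    "\<bar>real_of_int (lead_coeff Q)\<bar> \<le> 18 * x * H * h"
    "\<bar>real_of_int (lead_coeff Q)\<bar> * dist y w \<le> 18 * x * H / h"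
    "real_of_int (naive_height Q) / \<bar>real_of_int (lead_coeff Q)\<bar> \<ge> 1 / (10 * x)"
    "8 * H * h * \<epsilon> < 1 \<longrightarrow> real_of_int (naive_height Q) / \<bar>real_of_int (lead_coeff Q)\<bar> \<le> 10 / x"
proof -
  define p0 p1 p2 p3 where ps: "p0 = coeff P 0" "p1 = coeff P 1" "p2 = coeff P 2" "p3 = coeff P 3"
  have PE: "P = [:p0, p1, p2, p3:]" using cubic_eq_pCons[OF deg] by (simp add: ps)
  have p3: "p3 \<noteq> 0" using deg ps(4) leading_coeff_0_iff[of P] by auto
  have H: "\<bar>real_of_int p3\<bar> \<le> H" "H \<ge> 1"
    unfolding H_def ps using abs_coeff_le_naive_height[of P 3] naive_height_ge_1[of P] deg
    by (linarith, force)
  define \<alpha> where "\<alpha> = real_of_int p / of_int q"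
  define r where "r = real_of_int q"
  have r: "r \<ge> 1" using pq by (simp add: r_def)
  have pE: "real_of_int p = r * \<alpha>" using r by (simp add: \<alpha>_def r_def)
  have \<alpha>Q: "\<alpha> \<in> \<rat>" by (simp add: \<alpha>_def)
  have "\<xi> \<noteq> \<alpha>" using bspec[OF noroot \<alpha>Q] root by auto
  then have \<epsilon>: "\<epsilon> > 0" by (simp add: \<epsilon>_def \<alpha>_def)
  have xE: "x = r^2 * \<epsilon>" by (simp add: x_def r_def)
  have x0: "x > 0" using r \<epsilon> by (simp add: xE)
  have h: "h \<ge> r" by (simp add: h_def r_def)
  have hE: "h = r * max 1 \<bar>\<alpha>\<bar>"
    using r by (simp add: h_def r_def[symmetric] pE abs_mult max_mult_distrib_left of_int_max max.commute)
  define m where "m = max 1 \<bar>\<xi>\<bar>"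
  \<comment> \<open>Since \<open>r \<ge> 1\<close>, also \<open>\<epsilon>\<close> is small, so
    \<open>\<alpha>\<close> and \<open>\<xi>\<close> have comparable size and \<open>h\<close> may
    be traded for \<open>2 * r * m\<close>.\<close>
  have "\<epsilon> < 1/8"
    using small \<epsilon> mult_right_mono[of 1 "r^2" \<epsilon>] one_le_power[OF r, of 2] unfolding xE by linarith
  then have m: "max 1 \<bar>\<alpha>\<bar> \<le> 2 * m" unfolding m_def \<epsilon>_def \<alpha>_def[symmetric] by linarith
  have m1: "m \<ge> 1" by (simp add: m_def)
  have hm: "h \<le> 2 * r * m" using m r by (simp add: hE)
  obtain z w :: complex where zw: "z \<noteq> w"
    and vieta: "of_int p2 = - of_int p3 * (of_real \<xi> + z + w)"
    "of_int p1 = of_int p3 * (of_real \<xi> * z + of_real \<xi> * w + z * w)"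
    "of_int p0 = - of_int p3 * of_real \<xi> * z * w"
    and diff: "\<bar>real_of_int p3\<bar> * norm (z - w) * m \<le> 7 * H"
    and prod: "\<forall>x::real. \<bar>real_of_int p3\<bar> * norm (of_real x - z) * norm (of_real x - w) * m
       \<le> 9 * H * (max 1 \<bar>x\<bar>)^2"
    by (rule cubic_other_roots[OF PE p3 root noroot, folded m_def H_def])
  obtain a b where det: "a * p + b * q = 1" and a: "\<bar>a\<bar> \<le> q" using bezout_bounded[OF pq] .
  have detc: "of_int a * of_int p + of_int b * of_int q = (1::complex)"
    using det by (metis of_int_1 of_int_add of_int_mult)
  define Q where "Q = mobius_cubic p b q a P"
  have degQ: "degree Q = 3"
  proof -
    \<comment> \<open>This integer is \<open>q^3 * P(p/q)\<close>, non-zero since \<open>P\<close>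
      has no rational root.\<close>
    have "p3 * p^3 + p2 * p^2 * q + p1 * p * q^2 + p0 * q^3 \<noteq> 0"
    proof
      assume "p3 * p^3 + p2 * p^2 * q + p1 * p * q^2 + p0 * q^3 = 0"
      then have "real_of_int (p3 * p^3 + p2 * p^2 * q + p1 * p * q^2 + p0 * q^3) = 0" by simp
      then have "r^3 * (of_int p0 + of_int p1 * \<alpha> + of_int p2 * \<alpha>^2 + of_int p3 * \<alpha>^3) = 0"
        by (simp add: pE r_def[symmetric]) algebra
      then have "poly (map_poly of_int P) \<alpha> = 0" using r unfolding PE poly_of_int_cubic by simp
      then show False using bspec[OF noroot \<alpha>Q] by simp
    qed
    then show ?thesis unfolding Q_def mobius_cubic_def Let_def ps[symmetric] by simp
  qed
  have norootQ: "\<forall>x\<in>\<rat>. poly (map_poly of_int Q) (x::real) \<noteq> 0"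
    unfolding Q_def using mobius_cubic_no_rational_root[OF deg noroot det] by blast
  define B where "B = \<bar>real_of_int (lead_coeff Q)\<bar>"
  have leadQ: "lead_coeff Q = p3 * p^3 + p2 * p^2 * q + p1 * p * q^2 + p0 * q^3"
    unfolding degQ unfolding Q_def mobius_cubic_def Let_def ps[symmetric] by (simp add: numeral_3_eq_3)
  have B1: "B \<ge> 1"
  proof -
    have "Q \<noteq> 0" using degQ by auto
    then have "lead_coeff Q \<noteq> 0" by simp
    then show ?thesis unfolding B_def by linarith
  qed
  define n where "n v = norm (of_int p - of_int q * v :: complex)" for v
  have n_eq: "n v = r * norm (of_real \<alpha> - v)" for v
  proof -
    have "of_int p - of_int q * v = of_real r * (of_real \<alpha> - v)"
      using r by (simp add: \<alpha>_def r_def field_simps)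
    then show ?thesis using r by (simp add: n_def norm_mult)
  qed
  have n_xi: "n (of_real \<xi>) = r * \<epsilon>"
  proof -
    have "norm (complex_of_real \<alpha> - of_real \<xi>) = \<epsilon>"
      unfolding \<epsilon>_def \<alpha>_def[symmetric] of_real_diff[symmetric] norm_of_real by simp
    then show ?thesis by (simp add: n_eq)
  qed
  have BE: "B = \<bar>real_of_int p3\<bar> * n (of_real \<xi>) * n z * n w"
  proof -
    have "complex_of_int (lead_coeff Q) = of_int p3 * (of_int p - of_int q * of_real \<xi>)
        * (of_int p - of_int q * z) * (of_int p - of_int q * w)"
      unfolding leadQ of_int_add of_int_mult of_int_power vieta by algebra
    then have "norm (complex_of_int (lead_coeff Q)) = \<bar>real_of_int p3\<bar> * n (of_real \<xi>) * n z * n w"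
      unfolding n_def by (simp add: norm_mult)
    then show ?thesis by (simp add: B_def)
  qed
  have nz: "n z > 0" "n w > 0" "n (of_real \<xi>) > 0"
    using B1 unfolding BE n_def by (auto simp: zero_less_norm_iff)
  have rootP: "poly (map_poly of_int P) z = 0" "poly (map_poly of_int P) w = 0"
    unfolding PE poly_of_int_cubic vieta by algebra+
  define y where "y v = (of_int a * v + of_int b) / (of_int q * v - of_int p)" for v :: complex
  have y_root: "y v \<in> complex_roots Q" if "poly (map_poly of_int P) v = 0" "n v > 0" for v
    unfolding complex_roots_def Q_def y_def
    using that by (auto simp: n_def intro!: mobius_cubic_root[OF deg det])
  \<comment> \<open>By the determinant condition the difference of the two image fractions has
    numerator \<open>w - z\<close>.\<close>
  have y_diff: "n z * n w * dist (y z) (y w) = norm (z - w)"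
  proof -
    have ne: "of_int q * z - of_int p \<noteq> 0" "of_int q * w - of_int p \<noteq> 0" using nz by (auto simp: n_def)
    have "y z - y w = ((of_int a * z + of_int b) * (of_int q * w - of_int p)
        - (of_int a * w + of_int b) * (of_int q * z - of_int p))
        / ((of_int q * z - of_int p) * (of_int q * w - of_int p))"
      unfolding y_def using ne by (simp add: diff_frac_eq)
    also have "(of_int a * z + of_int b) * (of_int q * w - of_int p)
        - (of_int a * w + of_int b) * (of_int q * z - of_int p) = w - z"
      using detc by algebra
    finally have "dist (y z) (y w) = norm (z - w) / (n z * n w)"
      unfolding dist_norm n_def by (simp add: norm_divide norm_mult norm_minus_commute)
    then show ?thesis using nz by simp
  qed
  have y_ne: "y z \<noteq> y w"
  proof
    assume "y z = y w"
    then show False using y_diff zw by simp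
  qed
  \<comment> \<open>Both sides are multiplied by \<open>m\<close>. The bound \<open>prod\<close> at
    \<open>\<alpha>\<close> yields \<open>h * h\<close>; one \<open>h\<close> becomes
    \<open>2 * r * m\<close>, which doubles 9 to 18 and lets \<open>m\<close> cancel.\<close>
  have bound1: "B \<le> 18 * x * H * h"
  proof -
    have "B * m = r^3 * \<epsilon> * (\<bar>real_of_int p3\<bar> * norm (of_real \<alpha> - z) * norm (of_real \<alpha> - w) * m)"
      unfolding BE n_xi by (simp add: n_eq power3_eq_cube)
    also have "\<dots> \<le> r^3 * \<epsilon> * (9 * H * (max 1 \<bar>\<alpha>\<bar>)^2)"
      using spec[OF prod, of \<alpha>] r \<epsilon> by (intro mult_left_mono) auto
    also have "\<dots> = 9 * r * \<epsilon> * H * h * h" by (simp add: hE power2_eq_square power3_eq_cube)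
    also have "\<dots> \<le> 9 * r * \<epsilon> * H * h * (2 * r * m)"
      using r \<epsilon> H h hm by (intro mult_left_mono) auto
    also have "\<dots> = (18 * x * H * h) * m" by (simp add: xE power2_eq_square)
    finally show ?thesis using m1 by (subst (asm) mult_le_cancel_right) auto
  qed
  \<comment> \<open>The factors \<open>n z\<close> and \<open>n w\<close> of \<open>B\<close> cancel
    the denominators of \<open>y_diff\<close>, leaving the separation of \<open>z\<close> and
    \<open>w\<close>. Rounding 7 up to 9 gives the same constant 18 as before.\<close>
  have bound2: "B * dist (y z) (y w) \<le> 18 * x * H / h"
  proof -
    have "B * dist (y z) (y w) * h
        = r * \<epsilon> * \<bar>real_of_int p3\<bar> * (n z * n w * dist (y z) (y w)) * h"
      unfolding BE n_xi by simp
    also have "\<dots> \<le> r * \<epsilon> * \<bar>real_of_int p3\<bar> * norm (z - w) * (2 * r * m)"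
      unfolding y_diff using r \<epsilon> hm by (intro mult_left_mono) auto
    also have "\<dots> = 2 * x * (\<bar>real_of_int p3\<bar> * norm (z - w) * m)"
      by (simp add: xE power2_eq_square)
    also have "\<dots> \<le> 2 * x * (9 * H)" using diff x0 H by (intro mult_left_mono) auto
    finally show ?thesis using h r by (simp add: pos_le_divide_eq)
  qed
  have lower: "real_of_int (naive_height Q) / B \<ge> 1 / (10 * x)"
  proof -
    define e where "e = of_int q * \<xi> - of_int p"
    define \<eta> where "\<eta> = (of_int a * \<xi> + of_int b) / e"
    have e: "\<bar>e\<bar> = r * \<epsilon>"
    proof -
      have "e = r * (\<xi> - \<alpha>)" unfolding e_def pE by (simp add: r_def algebra_simps)
      then show ?thesis using r by (simp add: abs_mult \<epsilon>_def \<alpha>_def)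
    qed
    then have e0: "e \<noteq> 0" using r \<epsilon> by auto
    have "poly (map_poly of_int Q) \<eta> = 0"
      unfolding Q_def \<eta>_def e_def using e0 by (intro mobius_cubic_root[OF deg det root]) (simp add: e_def)
    \<comment> \<open>\<open>\<eta>\<close> is the image of \<open>\<xi>\<close>. From
      \<open>r * e * \<eta> = a * e + 1\<close> with \<open>r * \<bar>e\<bar> = x\<close> and
      \<open>\<bar>a * e\<bar> \<le> x\<close> it has size about \<open>1 / x\<close>; as
      \<open>1 / x \<ge> 8\<close>, a third of \<open>1 / x - 1\<close> exceeds
      \<open>1 / (10 * x)\<close>.\<close>
    moreover have \<eta>: "\<bar>\<eta>\<bar> \<ge> 1 / x - 1"
    proof -
      have "real_of_int (a * p + b * q) = 1" using det by simp
      then have "r * (of_int a * \<xi> + of_int b) = of_int a * e + 1"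
        unfolding e_def by (simp add: r_def algebra_simps)
      then have "r * e * \<eta> = of_int a * e + 1" using e0 by (simp add: \<eta>_def)
      then have "x * \<bar>\<eta>\<bar> = \<bar>of_int a * e + 1\<bar>"
        using e r by (metis abs_mult abs_of_nonneg mult.assoc order_trans power2_eq_square xE zero_le_one)
      moreover have "\<bar>of_int a * e\<bar> \<le> x"
      proof -
        have "\<bar>real_of_int a\<bar> \<le> r" using a by (simp add: r_def)
        then have "\<bar>of_int a * e\<bar> \<le> r * (r * \<epsilon>)" unfolding abs_mult e
          using r \<epsilon> by (intro mult_right_mono) auto
        then show ?thesis by (simp add: xE power2_eq_square)
      qed
      ultimately have "x * \<bar>\<eta>\<bar> \<ge> 1 - x" by linarith
      then show ?thesis using x0 by (simp add: field_simps)
    qed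
    moreover have x8: "1 / x \<ge> 8" using small x0 by (simp add: field_simps)
    ultimately have "B * \<bar>\<eta>\<bar> \<le> 3 * real_of_int (naive_height Q)"
      unfolding B_def by (intro cubic_root_le_height degQ) auto
    then have "real_of_int (naive_height Q) / B \<ge> \<bar>\<eta>\<bar> / 3" using B1 by (simp add: field_simps)
    moreover have "1 / (10 * x) = (1 / x) / 10" by simp
    ultimately show ?thesis using \<eta> x8 by linarith
  qed
  have upper: "real_of_int (naive_height Q) / B \<le> 10 / x" if liouville: "8 * H * h * \<epsilon> < 1"
  proof -
    \<comment> \<open>Liouville argument: if \<open>v\<close> were within \<open>1 / r^2\<close> of
      \<open>\<alpha>\<close>, then \<open>v'\<close> would be at distance at most
      \<open>8 * H / \<bar>p3\<bar>\<close> from it, where 8 = 1 + 7 by the triangle inequality. The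
      product formula then makes the positive integer \<open>B\<close> smaller than 1.\<close>
    have far: "1 / r \<le> n v"
      if BE': "B = \<bar>real_of_int p3\<bar> * (r * \<epsilon>) * n v * n v'"
        and d: "\<bar>real_of_int p3\<bar> * norm (v - v') \<le> 7 * H" for v v'
    proof (rule ccontr)
      assume "\<not> ?thesis"
      then have nv: "n v * r < 1" using r by (simp add: field_simps)
      have "norm (of_real \<alpha> - v) \<le> 1"
      proof -
        have "norm (of_real \<alpha> - v) \<le> r * norm (of_real \<alpha> - v)"
          using r mult_right_mono[of 1 r "norm (of_real \<alpha> - v)"] by simp
        also have "\<dots> \<le> r * (r * norm (of_real \<alpha> - v))"
          using r mult_right_mono[of 1 r "r * norm (of_real \<alpha> - v)"] by simp
        finally show ?thesis using nv by (simp add: n_eq mult.commute)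
      qed
      then have "\<bar>real_of_int p3\<bar> * norm (of_real \<alpha> - v) \<le> H"
        using H mult_left_mono[of "norm (of_real \<alpha> - v)" 1 "\<bar>real_of_int p3\<bar>"] by simp
      moreover have "\<bar>real_of_int p3\<bar> * norm (of_real \<alpha> - v')
          \<le> \<bar>real_of_int p3\<bar> * (norm (of_real \<alpha> - v) + norm (v - v'))"
        by (intro mult_left_mono norm_diff_triangle_le) auto
      ultimately have v': "\<bar>real_of_int p3\<bar> * norm (of_real \<alpha> - v') \<le> 8 * H"
        using d by (simp add: distrib_left)
      have "1 \<le> B" by (rule B1)
      also have "B = (n v * r) * (r * \<epsilon> * (\<bar>real_of_int p3\<bar> * norm (of_real \<alpha> - v')))"
        unfolding BE' n_eq[of v'] by simp
      also have "\<dots> \<le> 1 * (r * \<epsilon> * (8 * H))"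
        using nv r \<epsilon> v' by (intro mult_mono[of "n v * r"] mult_left_mono) auto
      also have "\<dots> \<le> 1 * (h * \<epsilon> * (8 * H))" using h \<epsilon> H by (intro mult_left_mono mult_right_mono) auto
      finally show False using liouville by (simp add: algebra_simps)
    qed
    have d7: "\<bar>real_of_int p3\<bar> * norm (z - w) \<le> 7 * H"
    proof -
      have "\<bar>real_of_int p3\<bar> * norm (z - w) * 1 \<le> \<bar>real_of_int p3\<bar> * norm (z - w) * m"
        using m1 by (intro mult_left_mono) auto
      then show ?thesis using diff by simp
    qed
    have farz: "1 / r \<le> n z" using far[of z w] BE d7 unfolding n_xi by simp
    have farw: "1 / r \<le> n w"
      using far[of w z] BE d7 unfolding n_xi by (simp add: norm_minus_commute algebra_simps)
    define g where "g v = norm (of_int b + of_int a * v :: complex)" for v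
    \<comment> \<open>\<open>g v\<close> is the size of the numerator of \<open>y v\<close>.
      Multiplied by \<open>q\<close>, this numerator is \<open>1 - a * (p - q * v)\<close>. For
      \<open>z\<close> and \<open>w\<close> the term \<open>1 / r\<close> is absorbed by
      \<open>far\<close>; for \<open>\<xi>\<close> it equals \<open>n \<xi> / x\<close>.\<close>
    have g_le: "g v \<le> 1 / r + n v" for v
    proof -
      have "of_int q * (of_int b + of_int a * v) = 1 - of_int a * (of_int p - of_int q * v)"
        using detc by algebra
      then have "norm (of_int q * (of_int b + of_int a * v)) = norm (1 - of_int a * (of_int p - of_int q * v))"
        by simp
      also have "\<dots> \<le> 1 + \<bar>real_of_int a\<bar> * n v"
        unfolding n_def by (rule order.trans[OF norm_triangle_ineq4]) (simp add: norm_mult)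
      also have "\<dots> \<le> 1 + r * n v"
        using a by (intro add_left_mono mult_right_mono) (auto simp: r_def n_def)
      finally have "r * g v \<le> 1 + r * n v" using pq by (simp add: g_def norm_mult r_def)
      then show ?thesis using r by (simp add: field_simps)
    qed
    have gz: "g z \<le> 2 * n z" "g w \<le> 2 * n w" using g_le[of z] g_le[of w] farz farw by auto
    have gx: "g (of_real \<xi>) \<le> 2 / x * n (of_real \<xi>)"
    proof -
      have "1 / r = n (of_real \<xi>) / x" unfolding n_xi xE using r \<epsilon> by (simp add: field_simps power2_eq_square)
      moreover have "n (of_real \<xi>) \<le> n (of_real \<xi>) / x"
        using x0 small nz by (simp add: field_simps)
      ultimately show ?thesis using g_le[of "of_real \<xi>"] by simp
    qed
    have g0: "g v \<ge> 0" for v by (simp add: g_def)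
    have n0: "n v \<ge> 0" for v by (simp add: n_def)
    define c3 where "c3 = \<bar>real_of_int p3\<bar>"
    have tri: "c3 * k1 * k2 * k3 \<le> l1 * l2 * l3 * B"
      if "k1 \<le> l1 * n (of_real \<xi>)" "k2 \<le> l2 * n z" "k3 \<le> l3 * n w"
        "0 \<le> k1" "0 \<le> k2" "0 \<le> k3" "0 \<le> l1" "0 \<le> l2" "0 \<le> l3" for k1 k2 k3 l1 l2 l3
    proof -
      have "c3 * k1 * k2 * k3 \<le> c3 * (l1 * n (of_real \<xi>)) * (l2 * n z) * (l3 * n w)"
        using that n0 by (intro mult_mono mult_nonneg_nonneg) (auto simp: c3_def)
      then show ?thesis by (simp add: BE c3_def algebra_simps)
    qed
    have x8: "8 \<le> 1 / x" using small x0 by (simp add: field_simps)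
    have B8: "8 * B \<le> B / x" using mult_right_mono[OF x8, of B] B1 by simp
    let ?X = "complex_of_real \<xi>"
    \<comment> \<open>\<open>Q\<close> is \<open>p3\<close> times the product of the linear factors
      \<open>U v * Y + V v\<close> over the three roots \<open>v\<close>; expanding gives its
      coefficients.\<close>
    define U V where "U v = of_int p - of_int q * v" "V v = of_int b + of_int a * v" for v :: complex
    have UV: "norm (U v) = n v" "norm (V v) = g v" for v by (auto simp: U_V_def n_def g_def)
    have q0: "complex_of_int (coeff Q 0) = of_int p3 * V ?X * V z * V w"
      unfolding Q_def mobius_cubic_def Let_def ps[symmetric] U_V_def
      by (simp add: vieta) algebra
    have q1: "complex_of_int (coeff Q 1) = of_int p3 * U ?X * V z * V w
       + of_int p3 * V ?X * U z * V w + of_int p3 * V ?X * V z * U w"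
      unfolding Q_def mobius_cubic_def Let_def ps[symmetric] U_V_def
      by (simp add: vieta) algebra
    have q2: "complex_of_int (coeff Q 2) = of_int p3 * U ?X * U z * V w
       + of_int p3 * U ?X * V z * U w + of_int p3 * V ?X * U z * U w"
      unfolding Q_def mobius_cubic_def Let_def ps[symmetric] U_V_def
      by (simp add: vieta numeral_eq_Suc) algebra
    have c0: "\<bar>real_of_int (coeff Q 0)\<bar> \<le> 10 / x * B"
    proof -
      have "\<bar>real_of_int (coeff Q 0)\<bar> = c3 * g ?X * g z * g w"
        using arg_cong[OF q0, of norm] by (simp add: norm_mult UV c3_def)
      then show ?thesis using tri[OF gx gz(1) gz(2)] g0 x0 B1 by simp
    qed
    have c1: "\<bar>real_of_int (coeff Q 1)\<bar> \<le> 10 / x * B"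
    proof -
      have "\<bar>real_of_int (coeff Q 1)\<bar> \<le> c3 * n ?X * g z * g w + c3 * g ?X * n z * g w + c3 * g ?X * g z * n w"
        using arg_cong[OF q1, of norm]
          norm_triangle_ineq[of "of_int p3 * U ?X * V z * V w + of_int p3 * V ?X * U z * V w" "of_int p3 * V ?X * V z * U w"]
          norm_triangle_ineq[of "of_int p3 * U ?X * V z * V w" "of_int p3 * V ?X * U z * V w"]
        by (simp add: norm_mult UV c3_def)
      also have "\<dots> \<le> 1 * 2 * 2 * B + 2 / x * 1 * 2 * B + 2 / x * 2 * 1 * B"
        using gx gz g0 n0 x0 by (intro add_mono tri) auto
      \<comment> \<open>The sum is \<open>(4 + 8 / x) * B\<close>, and \<open>8 \<le> 1 / x\<close>
        brings it below \<open>10 / x * B\<close>.\<close>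
      also have "\<dots> \<le> 10 / x * B" using B8 B1 x0 by (simp add: field_simps)
      finally show ?thesis .
    qed
    have c2: "\<bar>real_of_int (coeff Q 2)\<bar> \<le> 10 / x * B"
    proof -
      have "\<bar>real_of_int (coeff Q 2)\<bar> \<le> c3 * n ?X * n z * g w + c3 * n ?X * g z * n w + c3 * g ?X * n z * n w"
        using arg_cong[OF q2, of norm]
          norm_triangle_ineq[of "of_int p3 * U ?X * U z * V w + of_int p3 * U ?X * V z * U w" "of_int p3 * V ?X * U z * U w"]
          norm_triangle_ineq[of "of_int p3 * U ?X * U z * V w" "of_int p3 * U ?X * V z * U w"]
        by (simp add: norm_mult UV c3_def)
      also have "\<dots> \<le> 1 * 1 * 2 * B + 1 * 2 * 1 * B + 2 / x * 1 * 1 * B"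
        using gx gz g0 n0 x0 by (intro add_mono tri) auto
      also have "\<dots> \<le> 10 / x * B" using B8 B1 x0 by (simp add: field_simps)
      finally show ?thesis .
    qed
    have c3: "\<bar>real_of_int (coeff Q 3)\<bar> \<le> 10 / x * B"
      using B8 B1 degQ by (simp add: B_def)
    have "real_of_int (naive_height Q) \<le> 10 / x * B"
    proof (rule naive_height_le)
      fix i assume "i \<le> degree Q"
      then have "i = 0 \<or> i = 1 \<or> i = 2 \<or> i = 3" using degQ by auto
      then show "real_of_int \<bar>coeff Q i\<bar> \<le> 10 / x * B" using c0 c1 c2 c3 by auto
    qed
    then show ?thesis using B1 by (simp add: pos_divide_le_eq)
  qed
  show ?thesis
    by (rule that[OF degQ norootQ y_root[OF rootP(1) nz(1)] y_root[OF rootP(2) nz(2)] y_ne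
          bound1[unfolded B_def] bound2[unfolded B_def] lower[unfolded B_def] impI[OF upper[unfolded B_def]]])
qed

section \<open>Solving for the distance and the case distinction\<close>

text \<open>After \<open>x\<close> is replaced by its upper bound \<open>h^2 * \<epsilon>\<close>,
  taking the root of order \<open>s + t\<close> isolates \<open>\<epsilon>\<close>. The factor
  \<open>h^2\<close> accounts for the summand 2 in the exponent of \<open>h\<close>.\<close>

lemma extract_exponents:
  fixes c C s t x H h \<epsilon> :: real
  assumes pos: "c > 0" "C > 0" "s > 0" "t > 0" "x > 0" "\<epsilon> > 0" "H \<ge> 1" "h \<ge> 1"
    and x: "x \<le> h^2 * \<epsilon>"
    and le: "c \<le> C * (x powr (s + t) * H powr (2 + s) * h powr s)"
  shows "(c / C) powr (1 / (s + t)) * H powr (- (2 * (1 + s) / (s + t))) * h powr (- (2 + s / (s + t))) \<le> \<epsilon>"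
proof -
  define u v where uv: "u = 2 * (1 + s) / (s + t)" "v = 2 + s / (s + t)"
  have u: "u * (s + t) = 2 + 2 * s" and v: "v * (s + t) = 2 * (s + t) + s"
    using pos by (simp_all add: uv field_simps)
  have "c / C \<le> x powr (s + t) * H powr (2 + s) * h powr s"
    using le pos by (simp add: field_simps)
  \<comment> \<open>As \<open>H \<ge> 1\<close>, the exponent \<open>2 + s\<close> may be raised to
    \<open>2 + 2 * s\<close>, which equals \<open>u * (s + t)\<close>.\<close>
  also have "\<dots> \<le> (h^2 * \<epsilon>) powr (s + t) * H powr (2 + 2 * s) * h powr s"
    using pos x by (intro mult_right_mono mult_mono powr_mono powr_mono2) auto
  also have "\<dots> = \<epsilon> powr (s + t) * H powr (u * (s + t)) * h powr (v * (s + t))"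
  proof -
    have "h^2 = h powr 2" using pos by (simp add: powr_numeral)
    then have "(h^2) powr (s + t) = h powr (2 * (s + t))" by (simp only: powr_powr)
    moreover have "h powr (2 * (s + t) + s) = h powr (2 * (s + t)) * h powr s" by (rule powr_add)
    ultimately show ?thesis using pos unfolding u v by (simp only: powr_mult) simp
  qed
  also have "\<dots> = (\<epsilon> * H powr u * h powr v) powr (s + t)"
    using pos by (simp add: powr_mult powr_powr)
  finally have "(c / C) powr (1 / (s + t)) \<le> ((\<epsilon> * H powr u * h powr v) powr (s + t)) powr (1 / (s + t))"
    using pos by (intro powr_mono2) auto
  also have "\<dots> = \<epsilon> * H powr u * h powr v" using pos by (simp add: powr_powr)
  finally have "(c / C) powr (1 / (s + t)) / H powr u / h powr v \<le> \<epsilon>"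
    using pos by (simp add: field_simps)
  then show ?thesis unfolding uv[symmetric] by (simp add: powr_minus divide_inverse)
qed

theorem theorem1:
  fixes c s t :: real
  assumes "c > 0" and "s > 0" and "t > 0"
    and "\<And>Q :: int poly. irreducible Q \<Longrightarrow> degree Q = 3 \<Longrightarrow>
      (let B = real_of_int \<bar>lead_coeff Q\<bar>;
           A = real_of_int (naive_height Q) / B
       in sep Q \<ge> c / (B powr (2 + s) * A powr (2 - t)))"
  shows "(2 * (1 + s) / (s + t), 2 + s / (s + t)) \<in> distance_exponents 3 1"
proof -
  define u v where uv: "u = 2 * (1 + s) / (s + t)" "v = 2 + s / (s + t)"
  have u0: "u > 0" and v2: "v \<ge> 2" using assms(1-3) by (simp_all add: uv)
  \<comment> \<open>The 18 comes from the bounds on \<open>B\<close> (to the power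
    \<open>1 + s\<close>) and on \<open>B * dist y w\<close>, the 10 from those on \<open>A\<close>.
    The 1/8 in \<open>k\<close> serves the cases treated without \<open>Q\<close>.\<close>
  define C where "C = 18 powr (2 + s) * 10 powr \<bar>2 - t\<bar>"
  define k where "k = min (1 / 8) ((c / C) powr (1 / (s + t)))"
  have C0: "C > 0" by (simp add: C_def)
  have k0: "k > 0" using assms(1) C0 by (simp add: k_def)
  have "\<bar>\<xi> - \<alpha>\<bar> \<ge> k * real_of_int (alg_height \<xi>) powr (- u) * real_of_int (alg_height \<alpha>) powr (- v)"
    if \<xi>: "\<xi> \<in> algebraic_reals 3" and \<alpha>: "\<alpha> \<in> algebraic_reals 1" for \<xi> \<alpha>
  proof -
    obtain P where P: "degree P = 3" "alg_height \<xi> = naive_height P"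
      "poly (map_poly of_int P) \<xi> = 0"
      "\<forall>x\<in>\<rat>. poly (map_poly of_int P) (x::real) \<noteq> 0"
      by (rule alg_degree_3_min_poly[OF \<xi>])
    obtain p q where pq: "q > 0" "coprime p q" "\<alpha> = of_int p / of_int q" "alg_height \<alpha> = max \<bar>p\<bar> q"
      by (rule alg_degree_1_fraction[OF \<alpha>])
    define H where "H = real_of_int (naive_height P)"
    define h where "h = real_of_int (max \<bar>p\<bar> q)"
    define \<epsilon> where "\<epsilon> = \<bar>\<xi> - of_int p / of_int q\<bar>"
    define x where "x = (of_int q)^2 * \<epsilon>"
    have "P \<noteq> 0" using P(1) by auto
    then have H1: "H \<ge> 1" using naive_height_ge_1[of P] by (simp add: H_def)
    have qh: "real_of_int q \<le> h" "h \<ge> 1" using pq(1) by (auto simp: h_def)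
    have "of_int p / of_int q \<in> (\<rat> :: real set)" by simp
    then have "\<xi> \<noteq> of_int p / of_int q" using P(3,4) by metis
    then have \<epsilon>0: "\<epsilon> > 0" by (simp add: \<epsilon>_def)
    have x0: "x > 0" using \<epsilon>0 pq(1) by (simp add: x_def)
    have xh: "x \<le> h^2 * \<epsilon>" unfolding x_def using \<epsilon>0 qh pq(1)
      by (intro mult_right_mono power_mono) auto
    \<comment> \<open>Since \<open>H\<close> and \<open>h\<close> are at least 1, a bound with
      constant 1/8 and smaller exponents implies the one required.\<close>
    have scale: "k * H powr (- u) * h powr (- v) \<le> \<epsilon>" 
      if "1 / 8 * H powr (- i) * h powr (- j) \<le> \<epsilon>" "i \<le> u" "j \<le> v" for i j
    proof -
      have "k * H powr (- u) * h powr (- v) \<le> 1 / 8 * H powr (- i) * h powr (- j)"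
        using k0 that(2,3) H1 qh by (intro mult_mono powr_mono mult_nonneg_nonneg) (auto simp: k_def)
      then show ?thesis using that(1) by simp
    qed
    have "k * H powr (- u) * h powr (- v) \<le> \<epsilon>"
    proof (cases "x < 1 / 8 \<and> (t \<le> 2 \<longrightarrow> 8 * H * h * \<epsilon> < 1)")
      case True
      then have small: "(of_int q)^2 * \<bar>\<xi> - of_int p / of_int q\<bar> < 1 / 8"
        by (simp add: x_def \<epsilon>_def)
      obtain Q y w where Q: "degree Q = 3" "\<forall>x\<in>\<rat>. poly (map_poly of_int Q) (x::real) \<noteq> 0"
        "y \<in> complex_roots Q" "w \<in> complex_roots Q" "y \<noteq> w"
        and b1: "\<bar>real_of_int (lead_coeff Q)\<bar> \<le> 18 * x * H * h"
        and b2: "\<bar>real_of_int (lead_coeff Q)\<bar> * dist y w \<le> 18 * x * H / h"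
        and lower: "real_of_int (naive_height Q) / \<bar>real_of_int (lead_coeff Q)\<bar> \<ge> 1 / (10 * x)"
        and upper: "8 * H * h * \<epsilon> < 1 \<longrightarrow> real_of_int (naive_height Q) / \<bar>real_of_int (lead_coeff Q)\<bar> \<le> 10 / x"
        by (rule mobius_cubic_estimates[OF P(1,3,4) pq(2,1) small,
              folded \<epsilon>_def, folded x_def H_def h_def])
      define B where "B = \<bar>real_of_int (lead_coeff Q)\<bar>"
      define A where "A = real_of_int (naive_height Q) / B"
      have "Q \<noteq> 0" using Q(1) by auto
      then have B0: "B > 0" by (simp add: B_def)
      \<comment> \<open>The sign of \<open>2 - t\<close> decides whether the upper or the lower
        bound for \<open>A\<close> is the relevant one.\<close>
      have A: "A powr (2 - t) \<le> 10 powr \<bar>2 - t\<bar> * x powr (t - 2)"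
      proof (cases "t \<le> 2")
        case t: True
        have "A \<le> 10 / x" using upper True t by (simp add: A_def B_def)
        moreover have "A > 0" using lower x0 unfolding A_def B_def by (smt (verit) divide_pos_pos)
        ultimately have "A powr (2 - t) \<le> (10 / x) powr (2 - t)" using t by (intro powr_mono2) auto
        also have "\<dots> = 10 powr (2 - t) * x powr (- (2 - t))"
          by (simp only: powr_divide powr_minus_divide) simp
        finally show ?thesis using t by simp
      next
        case False
        have "A powr (2 - t) \<le> (1 / (10 * x)) powr (2 - t)"
          using lower x0 False by (intro powr_mono2') (auto simp: A_def B_def)
        also have "\<dots> = (10 * x) powr (- (2 - t))"
          by (simp only: powr_divide powr_minus_divide) simp
        finally show ?thesis using False x0 by (simp add: powr_mult)
      qed
      have "c \<le> B powr (2 + s) * A powr (2 - t) * dist y w"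
        using root_distance_from_sep_bound[OF assms(2,4) Q] by (simp add: A_def B_def)
      \<comment> \<open>The distance of the roots is controlled only together with a factor
        \<open>B\<close>, so one power of \<open>B\<close> is split off.\<close>
      also have "\<dots> = B powr (1 + s) * (B * dist y w) * A powr (2 - t)"
      proof -
        have "B powr (2 + s) = B powr (1 + s) * B"
          using B0 powr_add[of B "1 + s" 1] by (simp add: add_ac)
        then show ?thesis by simp
      qed
      also have "\<dots> \<le> (18 * x * H * h) powr (1 + s) * (18 * x * H / h) * (10 powr \<bar>2 - t\<bar> * x powr (t - 2))"
        using b1 b2 A B0 assms(2) x0 H1 qh
        by (intro mult_mono powr_mono2 mult_nonneg_nonneg) (auto simp: B_def)
      \<comment> \<open>The powers of \<open>x\<close> add up to (1 + s) + 1 + (t - 2) = s + t,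
        those of \<open>h\<close> to (1 + s) - 1 = s.\<close>
      also have "\<dots> = C * (x powr (s + t) * H powr (2 + s) * h powr s)"
      proof -
        have split: "y powr (2 + s) = y powr (1 + s) * y" if "y > 0" for y :: real
          using that powr_add[of y "1 + s" 1] by (simp add: add_ac)
        have "x powr (s + t) = x powr (2 + s) * x powr (t - 2)"
          by (simp add: powr_add[symmetric] add_ac)
        moreover have "h powr s = h powr (1 + s) / h"
          using qh powr_add[of h s 1] by (simp add: add_ac)
        ultimately show ?thesis
          using x0 H1 qh unfolding C_def by (simp add: powr_mult split[of x] split[of H] split[of 18])
      qed
      finally have "(c / C) powr (1 / (s + t)) * H powr (- u) * h powr (- v) \<le> \<epsilon>"
        unfolding uv using assms(1-3) C0 x0 \<epsilon>0 H1 qh xh by (intro extract_exponents) auto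
      moreover have "k * H powr (- u) * h powr (- v) \<le> (c / C) powr (1 / (s + t)) * H powr (- u) * h powr (- v)"
        by (intro mult_right_mono) (auto simp: k_def)
      ultimately show ?thesis by linarith
    next
      case False
      then consider "x \<ge> 1 / 8" | "t \<le> 2" "8 * H * h * \<epsilon> \<ge> 1" by linarith
      then show ?thesis
      proof cases
        case 1
        \<comment> \<open>If \<open>x\<close> is not small,
          \<open>\<epsilon> \<ge> 1 / (8 * h^2)\<close> already holds, and
          \<open>v \<ge> 2\<close>.\<close>
        have "1 / 8 * H powr (- 0) * h powr (- 2) \<le> \<epsilon>"
          using 1 xh H1 qh by (simp add: powr_minus powr_numeral field_simps)
        then show ?thesis by (rule scale) (use u0 v2 in auto)
      next
        case 2
        have "1 / 8 * H powr (- 1) * h powr (- 1) \<le> \<epsilon>"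
          using 2 H1 qh by (simp add: powr_minus field_simps)
        \<comment> \<open>The condition \<open>1 \<le> u\<close> amounts to
          \<open>t \<le> 2 + s\<close>, which follows from \<open>t \<le> 2\<close>.\<close>
        moreover have "1 \<le> u" using 2 assms(2,3) by (simp add: uv field_simps)
        ultimately show ?thesis by (rule scale) (use v2 in auto)
      qed
    qed
    then show ?thesis unfolding P(2) pq(4) H_def h_def \<epsilon>_def pq(3)[symmetric] .
  qed
  then have "distanced 3 1 u v" unfolding distanced_def using k0 by blast
  then show ?thesis using u0 v2 by (simp add: distance_exponents_def uv)
qed

end
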